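(* Let $f:\mathbb R^d\to\mathbb R$ be twice differentiable with $L_1$-Lipschitz gradient and $L_2$-Lipschitz Hessian on $\mathcal X=\{x\in\mathbb R^d:Ax\le b\}$, $A\in\mathbb R^{m\times d}$, $b\in\mathbb R^m$. Suppose that every KKT solution $(x^*,\mu^* )$ of the problem $\min_{x\in\mathcal X}f(x)$ satisfies the strict complementarity condition. Then for any $x^*\in\mathcal X$, $x^*$ is a $(0,0)$-SOSP1 if and only if it is a $(0,0)$-SOSP2.
   Context: $A_j$ is the $j$th row of $A$; $\mathcal A(x)=\{j: A_jx=b_j\}$; $A'(x)$ is the submatrix of $A$ consisting of the rows in $\mathcal A(x)$. $\pi_{\mathcal X}$ is Euclidean projection onto $\mathcal X$ and $g_\pi(x)=\frac1\alpha(\pi_{\mathcal X}(x-\alpha\nabla f(x))-x)$ for a fixed constant $\alpha>0$. KKT solution: $(x^*,\mu^* )$ with $x^*\in\mathcal X$, $\mu^*\ge0$, $\nabla f(x^* )+\sum_{j}\mu_j^*A_j^T=0$, $\mu_j^*(A_jx^*-b_j)=0$ for all $j$. Strict complementarity: for each $j\in[m]$ either $\mu_j^*>0$ and $A_jx^*=b_j$, or $\mu_j^*=0$ and $A_jx^*<b_j$. $x^*\in\mathcal X$ is a $(0,0)$-SOSP1 if $\|g_\pi(x^* )\|=0$ and $y^T\nabla^2f(x^* )y\ge0$ for all $y$ with $A'(x^* )y=0$. $x^*\in\mathcal X$ is a $(0,0)$-SOSP2 if $\nabla f(x^* )^T(x-x^* )\ge0$ for all $x\in\mathcal X$ with $\|x-x^*\|\le1$,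 and $(x-x^* )^T\nabla^2f(x^* )(x-x^* )\ge0$ for all $x\in\mathcal X$ with $\nabla f(x^* )^T(x-x^* )=0$. *)

theory Defs
  imports "HOL-Analysis.Analysis"
begin

definition gradient :: "(real ^ 'd \<Rightarrow> real) \<Rightarrow> real ^ 'd \<Rightarrow> real ^ 'd" where
  "gradient f x = (THE D. GDERIV f x :> D)"

definition hessian :: "(real ^ 'd \<Rightarrow> real) \<Rightarrow> real ^ 'd \<Rightarrow> real ^ 'd ^ 'd" where
  "hessian f x = jacobian (gradient f) (at x)"

definition twice_differentiable :: "(real ^ 'd \<Rightarrow> real) \<Rightarrow> bool" where
  "twice_differentiable f \<longleftrightarrow>
     (\<forall>x. f differentiable (at x)) \<and> (\<forall>x. gradient f differentiable (at x))"

lemma GDERIV_gradient: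
  assumes "f differentiable (at x)"
  shows "GDERIV f x :> gradient f x"
proof -
  obtain f' where f': "(f has_derivative f') (at x)"
    using assms unfolding differentiable_def by blast
  interpret f': bounded_linear f' using f' by (rule has_derivative_bounded_linear)
  have "f' = (\<lambda>h. h \<bullet> adjoint f' 1)"
    using adjoint_works[OF f'.linear_axioms] by (simp add: fun_eq_iff)
  with f' have D: "GDERIV f x :> adjoint f' 1"
    by (simp add: gderiv_def)
  moreover have "E = adjoint f' 1" if "GDERIV f x :> E" for E
  proof -
    have "(\<lambda>h. h \<bullet> E) = (\<lambda>h. h \<bullet> adjoint f' 1)"
      using that D unfolding gderiv_def by (rule has_derivative_unique)
    then have "\<forall>h. h \<bullet> E = h \<bullet> adjoint f' 1" by meson
    then show ?thesis by (simp add: vector_eq_ldot)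
  qed
  ultimately show ?thesis
    unfolding gradient_def by (rule theI)
qed

lemma has_derivative_gradient_hessian:
  assumes "gradient f differentiable (at x)"
  shows "(gradient f has_derivative (\<lambda>h. hessian f x *v h)) (at x)"
  using assms unfolding hessian_def by (simp add: jacobian_works[symmetric])

text \<open>The order on \<^typ>\<open>real ^ 'm\<close> is componentwise.\<close>

definition polyhedron_of :: "real ^ 'd ^ 'm \<Rightarrow> real ^ 'm \<Rightarrow> (real ^ 'd) set" where
  "polyhedron_of A b = {x. A *v x \<le> b}"

definition active :: "real ^ 'd ^ 'm \<Rightarrow> real ^ 'm \<Rightarrow> real ^ 'd \<Rightarrow> 'm set" where
  "active A b x = {j. row j A \<bullet> x = b $ j}"

definition proj_grad ::
    "real \<Rightarrow> (real ^ 'd) set \<Rightarrow> (real ^ 'd \<Rightarrow> real) \<Rightarrow> real ^ 'd \<Rightarrow> real ^ 'd" where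
  "proj_grad \<alpha> X f x = (1 / \<alpha>) *\<^sub>R (closest_point X (x - \<alpha> *\<^sub>R gradient f x) - x)"

definition KKT_solution ::
    "real ^ 'd ^ 'm \<Rightarrow> real ^ 'm \<Rightarrow> (real ^ 'd \<Rightarrow> real) \<Rightarrow> real ^ 'd \<Rightarrow> real ^ 'm \<Rightarrow> bool" where
  "KKT_solution A b f x \<mu> \<longleftrightarrow>
     x \<in> polyhedron_of A b \<and> 0 \<le> \<mu> \<and>
     gradient f x + (\<Sum>j\<in>UNIV. \<mu> $ j *\<^sub>R row j A) = 0 \<and>
     (\<forall>j. \<mu> $ j * (row j A \<bullet> x - b $ j) = 0)"

definition strict_complementarity ::
    "real ^ 'd ^ 'm \<Rightarrow> real ^ 'm \<Rightarrow> real ^ 'd \<Rightarrow> real ^ 'm \<Rightarrow> bool" where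
  "strict_complementarity A b x \<mu> \<longleftrightarrow>
     (\<forall>j. (\<mu> $ j > 0 \<and> row j A \<bullet> x = b $ j) \<or> (\<mu> $ j = 0 \<and> row j A \<bullet> x < b $ j))"

text \<open>The two notions of exact, that is \<open>(0, 0)\<close>, second-order stationary point.
  The submatrix \<open>A'(x)\<close> of active rows has a size depending on \<open>x\<close>; the equation
  \<open>A'(x) y = 0\<close> is therefore written out row by row.\<close>

definition SOSP1 ::
    "real \<Rightarrow> real ^ 'd ^ 'm \<Rightarrow> real ^ 'm \<Rightarrow> (real ^ 'd \<Rightarrow> real) \<Rightarrow> real ^ 'd \<Rightarrow> bool" where
  "SOSP1 \<alpha> A b f x \<longleftrightarrow>
     x \<in> polyhedron_of A b \<and>
     norm (proj_grad \<alpha> (polyhedron_of A b) f x) = 0 \<and>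
     (\<forall>y. (\<forall>j\<in>active A b x. row j A \<bullet> y = 0) \<longrightarrow> y \<bullet> (hessian f x *v y) \<ge> 0)"

definition SOSP2 ::
    "real ^ 'd ^ 'm \<Rightarrow> real ^ 'm \<Rightarrow> (real ^ 'd \<Rightarrow> real) \<Rightarrow> real ^ 'd \<Rightarrow> bool" where
  "SOSP2 A b f x \<longleftrightarrow>
     x \<in> polyhedron_of A b \<and>
     (\<forall>z\<in>polyhedron_of A b. norm (z - x) \<le> 1 \<longrightarrow> gradient f x \<bullet> (z - x) \<ge> 0) \<and>
     (\<forall>z\<in>polyhedron_of A b. gradient f x \<bullet> (z - x) = 0 \<longrightarrow>
        (z - x) \<bullet> (hessian f x *v (z - x)) \<ge> 0)"

text \<open>Lipschitz continuity of the Hessian is with respect to the spectral norm. The norm of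
  \<^typ>\<open>real ^ 'd ^ 'd\<close> is the Frobenius norm, hence the detour through bounded linear functions,
  which carry the operator norm.\<close>

definition hessian_op :: "(real ^ 'd \<Rightarrow> real) \<Rightarrow> real ^ 'd \<Rightarrow> (real ^ 'd) \<Rightarrow>\<^sub>L (real ^ 'd)" where
  "hessian_op f x = Blinfun (\<lambda>h. hessian f x *v h)"

lemma dist_hessian_op:
  "dist (hessian_op f x) (hessian_op f y) = onorm (\<lambda>h. (hessian f x - hessian f y) *v h)"
  by (simp add: dist_norm norm_blinfun.rep_eq minus_blinfun.rep_eq hessian_op_def
      bounded_linear_Blinfun_apply matrix_vector_mul_bounded_linear matrix_vector_mult_diff_rdistrib)

end

theory Submission
  imports Defs
begin

text \<open>Both notions contain the first-order condition that \<open>\<nabla>f(x)\<close> is nonnegative on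
  \<open>X - x\<close>: the fixed points of the projected gradient step are characterised by it, and by
  convexity it suffices to test points within distance 1. By Farkas' lemma it yields multipliers
  \<open>\<mu>\<close>, and strict complementarity makes them positive on all active rows. As \<open>\<nabla>f(x)\<close> is then a
  negative combination of the active rows, a feasible direction is orthogonal to \<open>\<nabla>f(x)\<close> iff all
  active rows vanish on it; conversely any vector on which the active rows vanish can be scaled
  to a feasible direction. So the two second-order conditions test the same directions.\<close>

text \<open>The nonnegative combinations form a convex cone containing the generators, so minimality
  of the hull applies. This turns hull membership into explicit multipliers in
  \<open>Farkas\<close>.\<close>

lemma convex_cone_hull_image_subset:
  fixes a :: "'i \<Rightarrow> 'a::real_vector"
  assumes "finite S"
  shows "convex_cone hull (a ` S) \<subseteq> {\<Sum>i\<in>S. u i *\<^sub>R a i | u. \<forall>i\<in>S. 0 \<le> u i}" (is "_ \<subseteq> ?C")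
proof (rule hull_minimal)
  show "a ` S \<subseteq> ?C"
  proof clarify
    fix k assume "k \<in> S"
    then have "(\<Sum>i\<in>S. (if i = k then 1 else 0) *\<^sub>R a i) = a k"
      using assms by (simp add: if_distrib[of "\<lambda>c. c *\<^sub>R _"] cong: if_cong)
    then show "\<exists>u. a k = (\<Sum>i\<in>S. u i *\<^sub>R a i) \<and> (\<forall>i\<in>S. 0 \<le> u i)"
      by (intro exI[of _ "\<lambda>i. if i = k then 1 else 0"]) auto
  qed
  show "convex_cone ?C"
    unfolding convex_cone_iff
  proof (intro conjI ballI allI impI)
    show "0 \<in> ?C"
      by (auto intro!: exI[of _ "\<lambda>_. 0"])
    show "x + y \<in> ?C" if "x \<in> ?C" "y \<in> ?C" for x y
    proof -
      from that obtain u v where "x = (\<Sum>i\<in>S. u i *\<^sub>R a i)" "\<forall>i\<in>S. 0 \<le> u i"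
        "y = (\<Sum>i\<in>S. v i *\<^sub>R a i)" "\<forall>i\<in>S. 0 \<le> v i"
        by blast
      then show ?thesis
        by (auto intro!: exI[of _ "\<lambda>i. u i + v i"] simp: scaleR_left_distrib sum.distrib)
    qed
    show "c *\<^sub>R x \<in> ?C" if "x \<in> ?C" "0 \<le> c" for x c
    proof -
      from that(1) obtain u where "x = (\<Sum>i\<in>S. u i *\<^sub>R a i)" "\<forall>i\<in>S. 0 \<le> u i"
        by blast
      with that(2) show ?thesis
        by (auto intro!: exI[of _ "\<lambda>i. c * u i"] simp: scaleR_sum_right)
    qed
  qed
qed

text \<open>A finitely generated convex cone is closed, so a point \<open>g\<close> outside it is
  strictly separated from it; the normal \<open>d\<close> of the hyperplane then violates
  \<open>nonneg\<close>.\<close>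

lemma Farkas:
  fixes a :: "'i \<Rightarrow> 'a::euclidean_space"
  assumes "finite S" and nonneg: "\<And>d. (\<And>i. i \<in> S \<Longrightarrow> 0 \<le> a i \<bullet> d) \<Longrightarrow> 0 \<le> g \<bullet> d"
  obtains u where "\<And>i. i \<in> S \<Longrightarrow> 0 \<le> u i" and "g = (\<Sum>i\<in>S. u i *\<^sub>R a i)"
proof -
  let ?K = "convex_cone hull (a ` S)"
  have "g \<in> ?K"
  proof (rule ccontr)
    assume "g \<notin> ?K"
    moreover have "closed ?K"
      using assms(1) by (intro closed_convex_cone_hull finite_imageI)
    ultimately obtain d \<beta> where d: "d \<bullet> g < \<beta>" "\<And>x. x \<in> ?K \<Longrightarrow> \<beta> < d \<bullet> x"
      using separating_hyperplane_closed_point[OF convex_convex_cone_hull] by blast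
    have "\<beta> < 0"
      using d(2)[OF convex_cone_hull_contains_0] by simp
    have "0 \<le> a i \<bullet> d" if "i \<in> S" for i
    proof (rule ccontr)
      assume "\<not> 0 \<le> a i \<bullet> d"
      then have neg: "d \<bullet> a i < 0"
        by (simp add: inner_commute)
      \<comment> \<open>The factor is positive, both numbers being negative, and puts the multiple
        of \<open>a i\<close> exactly on the hyperplane at level \<beta>, against strict
        separation.\<close>
      have "(\<beta> / (d \<bullet> a i)) *\<^sub>R a i \<in> ?K"
        using that \<open>\<beta> < 0\<close> neg
        by (intro convex_cone_hull_mul hull_inc) (auto simp: divide_nonpos_neg)
      from d(2)[OF this] neg show False
        by simp
    qed
    from nonneg[OF this] d(1) \<open>\<beta> < 0\<close> show False
      by (simp add: inner_commute)
  qed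
  with convex_cone_hull_image_subset[OF assms(1), of a] that show thesis
    by blast
qed

lemma closest_point_eq_iff:
  fixes X :: "'a::euclidean_space set"
  assumes "convex X" "closed X" "x \<in> X"
  shows "closest_point X p = x \<longleftrightarrow> (\<forall>z\<in>X. (p - x) \<bullet> (z - x) \<le> 0)"
proof
  assume "closest_point X p = x"
  then show "\<forall>z\<in>X. (p - x) \<bullet> (z - x) \<le> 0"
    using closest_point_dot[OF assms(1,2)] by metis
next
  assume *: "\<forall>z\<in>X. (p - x) \<bullet> (z - x) \<le> 0"
  let ?c = "closest_point X p"
  have "?c \<in> X"
    using assms by (intro closest_point_in_set) auto
  with * have "(p - x) \<bullet> (?c - x) \<le> 0" by blast
  moreover have "(p - ?c) \<bullet> (x - ?c) \<le> 0"
    by (rule closest_point_dot[OF assms])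
  \<comment> \<open>The left-hand sides of the two inequalities add up to the squared distance of
    \<open>?c\<close> and \<open>x\<close>.\<close>
  ultimately have "(?c - x) \<bullet> (?c - x) \<le> 0"
    by (simp add: algebra_simps inner_commute)
  then show "?c = x" by (metis inner_gt_zero_iff not_le right_minus_eq)
qed

lemma mem_polyhedron_of: "x \<in> polyhedron_of A b \<longleftrightarrow> (\<forall>j. row j A \<bullet> x \<le> b $ j)"
  by (simp add: polyhedron_of_def less_eq_vec_def matrix_vector_mul_component row_def)

lemma polyhedron_of_eq_INT: "polyhedron_of A b = (\<Inter>j. {x. row j A \<bullet> x \<le> b $ j})"
  by (auto simp: mem_polyhedron_of)

lemma convex_polyhedron_of: "convex (polyhedron_of A b)"
  unfolding polyhedron_of_eq_INT by (intro convex_INT ballI convex_halfspace_le)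

lemma closed_polyhedron_of: "closed (polyhedron_of A b)"
  unfolding polyhedron_of_eq_INT by (intro closed_INT ballI closed_halfspace_le)

text \<open>With \<open>p - x\<close> equal to -\<alpha> times the gradient, the variational
  inequality of the projection becomes stationarity after division by \<alpha>.\<close>

lemma proj_grad_eq_0_iff:
  assumes "\<alpha> > 0" "convex X" "closed X" "x \<in> X"
  shows "proj_grad \<alpha> X f x = 0 \<longleftrightarrow> (\<forall>z\<in>X. 0 \<le> gradient f x \<bullet> (z - x))"
  using assms by (simp add: proj_grad_def closest_point_eq_iff zero_le_mult_iff)

lemma stationary_local_iff_global:
  fixes X :: "'a::real_inner set"
  assumes "convex X" "x \<in> X" "0 < r"
  shows "(\<forall>z\<in>X. norm (z - x) \<le> r \<longrightarrow> 0 \<le> g \<bullet> (z - x)) \<longleftrightarrow> (\<forall>z\<in>X. 0 \<le> g \<bullet> (z - x))"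
proof (intro iffI ballI)
  fix z assume *: "\<forall>z\<in>X. norm (z - x) \<le> r \<longrightarrow> 0 \<le> g \<bullet> (z - x)" and "z \<in> X"
  \<comment> \<open>This \<open>t\<close> shrinks the segment to length below \<open>r\<close> and
    stays in (0, 1] even when \<open>z = x\<close>, which avoids a case distinction.\<close>
  define t where "t = r / (r + norm (z - x))"
  have pos: "0 < r + norm (z - x)"
    using assms(3) by (simp add: add_pos_nonneg)
  then have t: "0 < t" "t \<le> 1"
    using assms(3) by (simp_all add: t_def)
  have "(1 - t) *\<^sub>R x + t *\<^sub>R z \<in> X"
    using t assms \<open>z \<in> X\<close> by (intro convexD) auto
  moreover have eq: "(1 - t) *\<^sub>R x + t *\<^sub>R z - x = t *\<^sub>R (z - x)"
    by (simp add: algebra_simps)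
  moreover have "norm (t *\<^sub>R (z - x)) \<le> r"
    using pos assms(3) by (simp add: t_def pos_divide_le_eq mult_left_mono)
  ultimately have "0 \<le> g \<bullet> (t *\<^sub>R (z - x))"
    using * by metis
  then show "0 \<le> g \<bullet> (z - x)"
    using t by (simp add: zero_le_mult_iff)
qed blast

text \<open>Active constraints do not increase along \<open>d\<close>, and the slack of the others
  survives small steps by continuity. As there are finitely many rows, one \<open>t\<close> serves
  them all.\<close>

lemma feasible_direction:
  assumes x: "x \<in> polyhedron_of A b" and d: "\<And>j. j \<in> active A b x \<Longrightarrow> row j A \<bullet> d \<le> 0"
  obtains t where "0 < t" "x + t *\<^sub>R d \<in> polyhedron_of A b"
proof -
  have "\<forall>\<^sub>F t in at_right 0. row j A \<bullet> (x + t *\<^sub>R d) \<le> b $ j" for j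
  proof (cases "j \<in> active A b x")
    case True
    have "row j A \<bullet> (x + t *\<^sub>R d) \<le> b $ j" if "0 < t" for t
      using d[OF True] True that by (simp add: active_def inner_add_right mult_nonneg_nonpos)
    then show ?thesis
      by (auto intro: eventually_mono[OF eventually_at_right_less])
  next
    case False
    with x have "row j A \<bullet> x < b $ j"
      by (simp add: active_def mem_polyhedron_of order_less_le)
    moreover have "((\<lambda>t. row j A \<bullet> (x + t *\<^sub>R d)) \<longlongrightarrow> row j A \<bullet> (x + 0 *\<^sub>R d)) (at_right 0)"
      by (intro tendsto_intros)
    ultimately have "\<forall>\<^sub>F t in at_right 0. row j A \<bullet> (x + t *\<^sub>R d) < b $ j"
      by (intro order_tendstoD(2)) simp_all
    then show ?thesis
      by (rule eventually_mono) simp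
  qed
  then have "\<forall>\<^sub>F t in at_right 0. x + t *\<^sub>R d \<in> polyhedron_of A b"
    unfolding mem_polyhedron_of by (rule eventually_all_finite)
  with eventually_at_right_less[of "0::real"]
  have "\<forall>\<^sub>F t in at_right 0. 0 < t \<and> x + t *\<^sub>R d \<in> polyhedron_of A b"
    by (rule eventually_conj)
  from eventually_happens'[OF _ this] that show thesis
    by auto
qed

text \<open>The directions on which all negated active rows are nonnegative are feasible, so
  stationarity supplies the hypothesis of \<open>Farkas\<close> for these rows.\<close>

lemma stationary_imp_KKT:
  assumes x: "x \<in> polyhedron_of A b"
    and stat: "\<forall>z\<in>polyhedron_of A b. 0 \<le> gradient f x \<bullet> (z - x)"
  obtains \<mu> where "KKT_solution A b f x \<mu>"
proof -
  have "0 \<le> gradient f x \<bullet> d" if "\<And>j. j \<in> active A b x \<Longrightarrow> 0 \<le> - row j A \<bullet> d" for d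
  proof -
    have "row j A \<bullet> d \<le> 0" if "j \<in> active A b x" for j
      using \<open>\<And>j. j \<in> active A b x \<Longrightarrow> 0 \<le> - row j A \<bullet> d\<close>[OF that] by simp
    from feasible_direction[OF x this]
    obtain t where t: "0 < t" "x + t *\<^sub>R d \<in> polyhedron_of A b"
      by blast
    with stat have "0 \<le> gradient f x \<bullet> (x + t *\<^sub>R d - x)" by blast
    with t show ?thesis by (simp add: zero_le_mult_iff)
  qed
  then obtain u where u: "\<And>j. j \<in> active A b x \<Longrightarrow> 0 \<le> u j"
    "gradient f x = (\<Sum>j\<in>active A b x. u j *\<^sub>R - row j A)"
    using Farkas[of "active A b x" "\<lambda>j. - row j A" "gradient f x"] by auto
  \<comment> \<open>Extension by zero off the active set gives complementary slackness.\<close>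
  define \<mu> where "\<mu> = (\<chi> j. if j \<in> active A b x then u j else 0)"
  have "(\<Sum>j\<in>UNIV. \<mu> $ j *\<^sub>R row j A) = (\<Sum>j\<in>active A b x. u j *\<^sub>R row j A)"
    by (rule sum.mono_neutral_cong_right) (auto simp: \<mu>_def)
  with x u have "KKT_solution A b f x \<mu>"
    by (auto simp: KKT_solution_def \<mu>_def less_eq_vec_def active_def sum_negf)
  with that show thesis .
qed

text \<open>Complementary slackness removes the inactive rows from the stationarity
  equation.\<close>

lemma KKT_inner_gradient:
  assumes "KKT_solution A b f x \<mu>"
  shows "gradient f x \<bullet> d = - (\<Sum>j\<in>active A b x. \<mu> $ j * (row j A \<bullet> d))"
proof -
  have "(\<Sum>j\<in>UNIV. \<mu> $ j *\<^sub>R row j A) = (\<Sum>j\<in>active A b x. \<mu> $ j *\<^sub>R row j A)"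
    using assms by (intro sum.mono_neutral_right) (auto simp: KKT_solution_def active_def)
  with assms have "gradient f x = - (\<Sum>j\<in>active A b x. \<mu> $ j *\<^sub>R row j A)"
    by (simp add: KKT_solution_def add_eq_0_iff2)
  then show ?thesis
    by (simp add: inner_sum_left)
qed

text \<open>The inner product is a sum of nonnegative terms, so it vanishes iff each term does;
  strict positivity of the multipliers then passes this on to the rows themselves.\<close>

lemma strict_complementarity_orthogonal_iff:
  assumes KKT: "KKT_solution A b f x \<mu>" and sc: "strict_complementarity A b x \<mu>"
    and z: "z \<in> polyhedron_of A b"
  shows "gradient f x \<bullet> (z - x) = 0 \<longleftrightarrow> (\<forall>j\<in>active A b x. row j A \<bullet> (z - x) = 0)"
proof -
  have pos: "0 < \<mu> $ j" if "j \<in> active A b x" for j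
    using sc that by (force simp: strict_complementarity_def active_def)
  have "row j A \<bullet> (z - x) \<le> 0" if "j \<in> active A b x" for j
    using z that by (simp add: mem_polyhedron_of active_def inner_diff_right)
  with pos have "(\<Sum>j\<in>active A b x. - (\<mu> $ j * (row j A \<bullet> (z - x)))) = 0 \<longleftrightarrow>
      (\<forall>j\<in>active A b x. - (\<mu> $ j * (row j A \<bullet> (z - x))) = 0)"
    by (intro sum_nonneg_eq_0_iff) (auto simp: mult_nonneg_nonpos less_imp_le)
  with pos show ?thesis
    by (simp add: KKT_inner_gradient[OF KKT] sum_negf) (metis less_irrefl)
qed

theorem proposition3:
  fixes f :: "real ^ 'd \<Rightarrow> real"
    and A :: "real ^ 'd ^ 'm" and b :: "real ^ 'm"
    and L1 L2 \<alpha> :: real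
  assumes "\<alpha> > 0"
    and "twice_differentiable f"
    and "L1-lipschitz_on (polyhedron_of A b) (gradient f)"
    and "L2-lipschitz_on (polyhedron_of A b) (hessian_op f)"
    and "\<forall>x \<mu>. KKT_solution A b f x \<mu> \<longrightarrow> strict_complementarity A b x \<mu>"
  shows "\<forall>x\<in>polyhedron_of A b. SOSP1 \<alpha> A b f x \<longleftrightarrow> SOSP2 A b f x"
proof
  fix x assume x: "x \<in> polyhedron_of A b"
  let ?g = "gradient f x" and ?H = "hessian f x" and ?X = "polyhedron_of A b"
  let ?stat = "\<forall>z\<in>?X. 0 \<le> ?g \<bullet> (z - x)"
  \<comment> \<open>The second-order conditions are compared under stationarity, which provides the
    multipliers and is part of both notions.\<close>
  have "(\<forall>y. (\<forall>j\<in>active A b x. row j A \<bullet> y = 0) \<longrightarrow> y \<bullet> (?H *v y) \<ge> 0) \<longleftrightarrow>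
      (\<forall>z\<in>?X. ?g \<bullet> (z - x) = 0 \<longrightarrow> (z - x) \<bullet> (?H *v (z - x)) \<ge> 0)"
    (is "?L \<longleftrightarrow> ?R") if stat: ?stat
  proof -
    obtain \<mu> where KKT: "KKT_solution A b f x \<mu>"
      using stationary_imp_KKT[OF x stat] .
    with assms(5) have sc: "strict_complementarity A b x \<mu>" by blast
    note orth = strict_complementarity_orthogonal_iff[OF KKT sc]
    show ?thesis
    proof (intro iffI allI impI)
      assume ?L then show ?R using orth by blast
    next
      fix y assume R: ?R and y: "\<forall>j\<in>active A b x. row j A \<bullet> y = 0"
      obtain t where t: "0 < t" "x + t *\<^sub>R y \<in> ?X"
        using feasible_direction[OF x, of y] y by auto
      have "?g \<bullet> (x + t *\<^sub>R y - x) = 0"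
        using orth[OF t(2)] y by simp
      \<comment> \<open>The quadratic form scales by the square of \<open>t\<close>, so its sign at
        the feasible multiple decides its sign at \<open>y\<close>.\<close>
      with R t have "0 \<le> (t *\<^sub>R y) \<bullet> (?H *v (t *\<^sub>R y))"
        by (metis add_diff_cancel_left')
      with t show "0 \<le> y \<bullet> (?H *v y)"
        by (simp add: matrix_vector_mult_scaleR zero_le_mult_iff)
    qed
  qed
  then show "SOSP1 \<alpha> A b f x \<longleftrightarrow> SOSP2 A b f x"
    using x proj_grad_eq_0_iff[OF assms(1) convex_polyhedron_of closed_polyhedron_of x, of f]
      stationary_local_iff_global[OF convex_polyhedron_of x zero_less_one, of ?g]
    by (simp add: SOSP1_def SOSP2_def) blast
qed

end
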